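(* Let $(\Omega,\mathcal F,\mathbb P)$ be a probability space with $\Omega=E\sqcup E^c$, $\mathbb P(E)=p\in(0,\tfrac12]$, and let $\mathcal F_1=\{\varnothing,\Omega\}$ and $\mathcal F_n=\mathcal F_\infty=\{\varnothing,E,E^c,\Omega\}$ for $n\ge2$. Fix $\lambda>0$ and let $f:=\frac{\lambda}{p}\mathbf 1_E$, so $\|f\|_1=\lambda$. Then every decomposition $f=g+h+k$ with $g,h,k\in L^1(\mathcal F_\infty)$ and $0\le k\le\lambda$ a.s. satisfies $$\mathbb P\Bigl(\sup_{n\ge1}|\mathbb E_n[g]|>0\Bigr)=1\qquad\text{or}\qquad \Bigl\|\sum_{n=1}^\infty\bigl|\mathbb E_n[h]-\mathbb E_{n-1}[h]\bigr|\Bigr\|_1\ge2(1-p)\|f\|_1.$$ Consequently, there is no pair of constants $c_1<1$ and $c_2<2$ such that, for every complete probability space with a discrete filtration $(\mathcal F_n)_{n\ge1}$, every $f\ge0$ in $L^1(\mathcal F_\infty)$ and every $\lambda>0$, there exists a decomposition $f=g+h+k$ with $g,h,k\in L^1(\mathcal F_\infty)$, $0\le k\le\lambda$ a.s., $$\mathbb P\Bigl(\sup_{n\ge1}|\mathbb E_n[g]|>0\Bigr)\le c_1\frac{\|f\|_1}{\lambda}\qquad\text{and}\qquad \Bigl\|\sum_{n=1}^\infty\bigl|\mathbb E_n[h]-\mathbb E_{n-1}[h]\bigr|\Bigr\|_1\le c_2\|f\|_1.$$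
   Context: For a filtration $(\mathcal F_n)_{n\ge1}$, $\mathcal F_\infty:=\sigma\bigl(\bigcup_{n\ge1}\mathcal F_n\bigr)$, $\mathbb E_n:=\mathbb E[\,\cdot\mid\mathcal F_n]$ for $n\ge1$, and $\mathbb E_0\equiv0$ (the zero operator). $L^1(\mathcal F_\infty)$ denotes the $\mathcal F_\infty$-measurable real-valued functions in $L^1(\Omega,\mathbb P)$, and $\|\cdot\|_1$ is the $L^1(\Omega,\mathbb P)$ norm. *)

theory Defs
  imports "HOL-Probability.Probability"
begin

text \<open>Filtrations are indexed by \<open>n \<ge> 1\<close>; the value of \<open>F\<close> at \<open>0\<close> is irrelevant everywhere.
  Only the \<open>\<sigma>\<close>-algebra of \<open>F n\<close> matters, not its measure.\<close>

definition discrete_filtration :: "'a measure \<Rightarrow> (nat \<Rightarrow> 'a measure) \<Rightarrow> bool" where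
  "discrete_filtration M F \<longleftrightarrow>
     filtration (space M) (\<lambda>n. F (Suc n)) \<and> (\<forall>n\<ge>1. subalgebra M (F n))"

definition F_infty :: "'a measure \<Rightarrow> (nat \<Rightarrow> 'a measure) \<Rightarrow> 'a measure" where
  "F_infty M F = sigma (space M) (\<Union>n\<in>{1..}. sets (F n))"

definition L1_infty :: "'a measure \<Rightarrow> (nat \<Rightarrow> 'a measure) \<Rightarrow> ('a \<Rightarrow> real) set" where
  "L1_infty M F = {f. f \<in> borel_measurable (F_infty M F) \<and> integrable M f}"

definition L1_norm :: "'a measure \<Rightarrow> ('a \<Rightarrow> real) \<Rightarrow> real" where
  "L1_norm M f = (\<integral>x. \<bar>f x\<bar> \<partial>M)"

definition cexp :: "'a measure \<Rightarrow> (nat \<Rightarrow> 'a measure) \<Rightarrow> nat \<Rightarrow> ('a \<Rightarrow> real) \<Rightarrow> 'a \<Rightarrow> real" where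
  "cexp M F n f = (if n = 0 then (\<lambda>x. 0) else real_cond_exp M (F n) f)"

text \<open>The supremum is formed in \<^typ>\<open>ennreal\<close>, since it may be infinite.\<close>

definition prob_sup_pos :: "'a measure \<Rightarrow> (nat \<Rightarrow> 'a measure) \<Rightarrow> ('a \<Rightarrow> real) \<Rightarrow> real" where
  "prob_sup_pos M F g =
     measure M {x \<in> space M. (SUP n\<in>{1..}. ennreal \<bar>cexp M F n g x\<bar>) > 0}"

text \<open>The series and its \<open>L\<^sup>1\<close> norm may be infinite. The norm is returned in \<^typ>\<open>ereal\<close>, so that
  bounds by a possibly negative real constant are not truncated at \<open>0\<close>.
  The summation index is shifted: the \<open>n\<close>-th summand is the increment from \<open>n\<close> to \<open>n + 1\<close>.\<close>

definition variation_norm :: "'a measure \<Rightarrow> (nat \<Rightarrow> 'a measure) \<Rightarrow> ('a \<Rightarrow> real) \<Rightarrow> ereal" where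
  "variation_norm M F h =
     enn2ereal (\<integral>\<^sup>+ x. (\<Sum>n. ennreal \<bar>cexp M F (Suc n) h x - cexp M F n h x\<bar>) \<partial>M)"

text \<open>As usual in \<open>L\<^sup>1\<close>, the identity \<open>f = g + h + k\<close> is understood almost surely.\<close>

definition decomposition ::
  "'a measure \<Rightarrow> (nat \<Rightarrow> 'a measure) \<Rightarrow> real \<Rightarrow> ('a \<Rightarrow> real)
     \<Rightarrow> ('a \<Rightarrow> real) \<Rightarrow> ('a \<Rightarrow> real) \<Rightarrow> ('a \<Rightarrow> real) \<Rightarrow> bool" where
  "decomposition M F l f g h k \<longleftrightarrow>
     g \<in> L1_infty M F \<and> h \<in> L1_infty M F \<and> k \<in> L1_infty M F \<and>
     (AE x in M. f x = g x + h x + k x) \<and> (AE x in M. 0 \<le> k x \<and> k x \<le> l)"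

end

theory Submission
  imports Defs
begin

text \<open>
  If the maximal function of \<open>g\<close> vanishes at some point, then \<open>\<E>[g] = 0\<close>, and since \<open>\<F>\<^sub>\<infinity>\<close> has
  only the two atoms \<open>E\<close> and \<open>E\<^sup>c\<close>, the function \<open>g\<close> has constant sign; hence \<open>g = 0\<close> and
  \<open>h = f - k \<ge> f - \<lambda>\<close>. The variation of \<open>h\<close> is \<open>\<bar>\<E>[h]\<bar> + \<bar>h - \<E>[h]\<bar>\<close>, which is at least
  \<open>\<E>[h] + (h - \<E>[h]) s\<close> for the sign \<open>s = 1\<^sub>E - 1\<^sub>E\<^sub>c\<close>. Its expectation is
  \<open>\<E>[h ((3 - 2p) 1\<^sub>E + (1 - 2p) 1\<^sub>E\<^sub>c)]\<close>; the weights are nonnegative because \<open>p \<le> 1/2\<close>, so \<open>h\<close> may be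
  replaced by \<open>f - \<lambda>\<close>, which gives exactly \<open>2 (1 - p) \<lambda>\<close>. Letting \<open>p\<close> tend to \<open>0\<close> on a two-atom
  probability space rules out \<open>c\<^sub>2 < 2\<close>.
\<close>

section \<open>The filtration with atoms \<open>E\<close> and its complement\<close>

locale two_set_filtration = prob_space M for M :: "'a measure" +
  fixes E :: "'a set" and F :: "nat \<Rightarrow> 'a measure"
  assumes E_sets [measurable]: "E \<in> sets M"
    and prob_E_pos: "0 < prob E"
    and prob_E_le: "prob E \<le> 1/2"
    and sets_F1: "sets (F 1) = {{}, space M}"
    and sets_Fn: "n \<ge> 2 \<Longrightarrow> sets (F n) = {{}, E, space M - E, space M}"
begin

text \<open>The locale fixes only the sets of each \<open>F n\<close>; the space is recovered as
  their union.\<close>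

lemma subalgebra_F:
  assumes "n \<ge> 1"
  shows "subalgebra M (F n)"
proof -
  have s: "sets (F n) = {{}, space M} \<or> sets (F n) = {{}, E, space M - E, space M}"
    using sets_F1 sets_Fn[of n] assms by (cases "n = 1") auto
  moreover have "E \<subseteq> space M"
    using E_sets by (rule sets.sets_into_space)
  ultimately have "\<Union>(sets (F n)) = space M"
    by auto
  moreover have "\<Union>(sets (F n)) = space (F n)"
    using sets.sets_into_space sets.top by blast
  ultimately show ?thesis
    using s by (auto simp: subalgebra_def)
qed

lemma space_F: "n \<ge> 1 \<Longrightarrow> space (F n) = space M"
  using subalgebra_F by (simp add: subalgebra_def)

lemma sigma_finite_subalgebra_F: "n \<ge> 1 \<Longrightarrow> sigma_finite_subalgebra M (F n)"
  using finite_measure_subalgebra.intro[OF finite_measure_axioms]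
    finite_measure_subalgebra_axioms.intro[OF subalgebra_F]
    finite_measure_subalgebra_is_sigma_finite by blast

text \<open>Every \<open>F n\<close> with n \<ge> 1 lies inside \<open>F 2\<close>, so the
  generating union is already a sigma-algebra.\<close>

lemma sets_F_infty: "sets (F_infty M F) = {{}, E, space M - E, space M}"
proof -
  have "sets (F n) \<subseteq> sets (F 2)" if "n \<ge> 1" for n
    using sets_F1 sets_Fn[of n] sets_Fn[of 2] that by (cases "n = 1") auto
  then have "(\<Union>n\<in>{1..}. sets (F n)) = sets (F 2)"
    by fastforce
  moreover have "sets (F 2) \<subseteq> Pow (space M)"
    using space_F[of 2] sets.space_closed[of "F 2"] by simp
  ultimately have "sets (F_infty M F) = sigma_sets (space M) (sets (F 2))"
    by (simp add: F_infty_def)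
  also have "\<dots> = sets (F 2)"
    using sets.sigma_sets_eq[of "F 2"] space_F[of 2] by simp
  finally show ?thesis
    using sets_Fn by simp
qed

lemma measurable_F2: "u \<in> L1_infty M F \<Longrightarrow> u \<in> borel_measurable (F 2)"
  using measurable_cong_sets[of "F_infty M F" "F 2" borel borel] sets_F_infty sets_Fn[of 2]
  by (auto simp: L1_infty_def)

section \<open>Conditional expectations at levels one and two\<close>

lemma cexp_measurable:
  assumes "n \<ge> 1"
  shows "cexp M F n u \<in> borel_measurable (F n)"
  using assms by (simp add: cexp_def)

text \<open>A function measurable for the trivial sigma-algebra is constant, and the constant must
  be the mean. Hence the identity holds at every point, so that a single zero of the first
  conditional expectation forces a vanishing mean.\<close>

lemma cexp_1_eq:
  assumes "integrable M u" "x \<in> space M"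
  shows "cexp M F 1 u x = expectation u"
proof -
  let ?G = "real_cond_exp M (F 1) u"
  interpret A: sigma_finite_subalgebra M "F 1"
    by (rule sigma_finite_subalgebra_F) simp
  have const: "?G y = ?G x" if "y \<in> space M" for y
  proof -
    have "?G -` {?G x} \<inter> space (F 1) \<in> sets (F 1)"
      by (rule measurable_sets[OF borel_measurable_cond_exp]) simp
    then have "?G -` {?G x} \<inter> space M = {} \<or> ?G -` {?G x} \<inter> space M = space M"
      unfolding sets_F1 space_F[OF order_refl] by blast
    then show ?thesis
      using assms(2) that by blast
  qed
  have "expectation u = expectation ?G"
    using A.real_cond_exp_int(2)[OF assms(1)] by simp
  also have "\<dots> = expectation (\<lambda>_. ?G x)"
    by (intro Bochner_Integration.integral_cong const refl)
  finally show ?thesis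
    by (simp add: cexp_def prob_space)
qed

lemma AE_cexp_2_eq:
  assumes "u \<in> L1_infty M F"
  shows "AE x in M. cexp M F 2 u x = u x"
proof -
  interpret A: sigma_finite_subalgebra M "F 2"
    by (rule sigma_finite_subalgebra_F) simp
  show ?thesis
    using A.real_cond_exp_F_meas[of u] assms measurable_F2[OF assms]
    by (auto simp: cexp_def L1_infty_def)
qed

lemma prob_sup_pos_dichotomy:
  assumes g: "g \<in> L1_infty M F"
  shows "prob_sup_pos M F g = 1 \<or> (AE x in M. g x = 0)"
\<comment> \<open>The split is on the existence of a common zero of the chosen versions. Without
  one, the supremum is positive at every point.\<close>
proof (cases "\<exists>x0\<in>space M. \<forall>n\<ge>1. cexp M F n g x0 = 0")
  case False
  have "(SUP n\<in>{1..}. ennreal \<bar>cexp M F n g x\<bar>) > 0" if "x \<in> space M" for x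
    using False that by (auto simp: less_SUP_iff)
  then have "{x \<in> space M. (SUP n\<in>{1..}. ennreal \<bar>cexp M F n g x\<bar>) > 0} = space M"
    by blast
  then show ?thesis
    by (simp add: prob_sup_pos_def prob_space)
next
  case True
  then obtain x0 where x0: "x0 \<in> space M" "\<And>n. n \<ge> 1 \<Longrightarrow> cexp M F n g x0 = 0"
    by blast
  have int: "integrable M g"
    using g by (simp add: L1_infty_def)
  have mean: "expectation g = 0"
    using cexp_1_eq[OF int x0(1)] x0(2)[of 1] by simp
  \<comment> \<open>Signs are read off from the version \<open>?G\<close>, which is known to vanish
    at \<open>x0\<close>; \<open>g\<close> agrees with it only almost everywhere.\<close>
  let ?G = "cexp M F 2 g"
  let ?A = "{x \<in> space M. ?G x > 0}" and ?B = "{x \<in> space M. ?G x < 0}"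
  have [measurable]: "?G \<in> borel_measurable (F 2)"
    by (rule cexp_measurable) simp
  have "{x \<in> space (F 2). ?G x > 0} \<in> sets (F 2)" "{x \<in> space (F 2). ?G x < 0} \<in> sets (F 2)"
    by measurable
  then have "?A \<in> {{}, E, space M - E, space M}" "?B \<in> {{}, E, space M - E, space M}"
    using space_F[of 2] sets_Fn[of 2] by simp_all
  moreover have "?A \<inter> ?B = {}" "x0 \<notin> ?A" "x0 \<notin> ?B"
    using x0(2)[of 2] by auto
  \<comment> \<open>A nonempty member of the algebra that misses \<open>x0\<close> is the atom not
    containing \<open>x0\<close>; two disjoint sets cannot both equal it.\<close>
  moreover have "A = {} \<or> B = {}"
    if "A \<in> {{}, E, space M - E, space M}" "B \<in> {{}, E, space M - E, space M}"
      "A \<inter> B = {}" "x0 \<notin> A" "x0 \<notin> B" for A B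
    using that x0(1) by (elim insertE emptyE) simp_all
  ultimately have "?A = {} \<or> ?B = {}"
    by blast
  then have "(\<forall>x\<in>space M. ?G x \<le> 0) \<or> (\<forall>x\<in>space M. ?G x \<ge> 0)"
    by (force simp: not_less[symmetric])
  then have "(AE x in M. g x \<le> 0) \<or> (AE x in M. g x \<ge> 0)"
  proof
    assume "\<forall>x\<in>space M. ?G x \<le> 0"
    then have "AE x in M. ?G x \<le> 0" by auto
    with AE_cexp_2_eq[OF g] have "AE x in M. g x \<le> 0" by eventually_elim simp
    then show ?thesis ..
  next
    assume "\<forall>x\<in>space M. ?G x \<ge> 0"
    then have "AE x in M. ?G x \<ge> 0" by auto
    with AE_cexp_2_eq[OF g] have "AE x in M. g x \<ge> 0" by eventually_elim simp
    then show ?thesis ..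
  qed
  moreover have "AE x in M. g x = 0" if "AE x in M. g x \<ge> 0"
    using integral_nonneg_eq_0_iff_AE[OF int that] mean by simp
  moreover have "AE x in M. g x = 0" if "AE x in M. g x \<le> 0"
    using integral_nonneg_eq_0_iff_AE[of M "\<lambda>x. - g x"] that int mean by simp
  ultimately have "AE x in M. g x = 0"
    by blast
  then show ?thesis ..
qed

section \<open>Lower bounds for the variation\<close>

text \<open>The right-hand side is the mean of the first two terms of the series; the other terms
  are nonnegative and are dropped.\<close>

lemma variation_norm_ge:
  assumes h: "h \<in> L1_infty M F"
  shows "variation_norm M F h \<ge> ereal (\<bar>expectation h\<bar> + expectation (\<lambda>x. \<bar>h x - expectation h\<bar>))"
proof -
  let ?m = "expectation h"
  let ?d = "\<lambda>n x. ennreal \<bar>cexp M F (Suc n) h x - cexp M F n h x\<bar>"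
  have int: "integrable M h"
    using h by (simp add: L1_infty_def)
  have two_terms: "AE x in M. ennreal (\<bar>?m\<bar> + \<bar>h x - ?m\<bar>) \<le> (\<Sum>n. ?d n x)"
    using AE_cexp_2_eq[OF h] AE_space
  proof eventually_elim
    case (elim x)
    \<comment> \<open>Since \<open>cexp\<close> at index 0 is zero, the summand with n = 0 is the
      absolute mean.\<close>
    have "ennreal (\<bar>?m\<bar> + \<bar>h x - ?m\<bar>) = (\<Sum>n<2. ?d n x)"
      using elim cexp_1_eq[OF int, of x]
      by (simp add: numeral_2_eq_2 cexp_def[of _ _ 0] ennreal_plus)
    also have "\<dots> \<le> (\<Sum>n. ?d n x)"
      by (rule sum_le_suminf) auto
    finally show ?case .
  qed
  have "\<bar>?m\<bar> + expectation (\<lambda>x. \<bar>h x - ?m\<bar>) = expectation (\<lambda>x. \<bar>?m\<bar> + \<bar>h x - ?m\<bar>)"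
    using int by (simp add: prob_space)
  then have "ennreal (\<bar>?m\<bar> + expectation (\<lambda>x. \<bar>h x - ?m\<bar>))
      = (\<integral>\<^sup>+ x. ennreal (\<bar>?m\<bar> + \<bar>h x - ?m\<bar>) \<partial>M)"
    using int by (subst nn_integral_eq_integral) auto
  also have "\<dots> \<le> (\<integral>\<^sup>+ x. (\<Sum>n. ?d n x) \<partial>M)"
    by (rule nn_integral_mono_AE[OF two_terms])
  finally have "enn2ereal (ennreal (\<bar>?m\<bar> + expectation (\<lambda>x. \<bar>h x - ?m\<bar>))) \<le> variation_norm M F h"
    by (simp add: variation_norm_def less_eq_ennreal.rep_eq)
  \<comment> \<open>Nonnegativity ensures that \<open>ennreal\<close> does not truncate the
    bound.\<close>
  moreover have "0 \<le> \<bar>?m\<bar> + expectation (\<lambda>x. \<bar>h x - ?m\<bar>)"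
    by (intro add_nonneg_nonneg integral_nonneg_AE) auto
  ultimately show ?thesis
    by (simp only: enn2ereal_ennreal)
qed

lemma variation_norm_ge_of_ge:
  assumes h: "h \<in> L1_infty M F" and "l > 0"
    and ge: "AE x in M. h x \<ge> l / prob E * indicator E x - l"
  shows "variation_norm M F h \<ge> ereal (2 * (1 - prob E) * l)"
proof -
  define p where "p = prob E"
  define m where "m = expectation h"
  let ?i = "indicator E :: 'a \<Rightarrow> real"
  \<comment> \<open>With s = 2 * \<open>?i\<close> - 1, whose mean is 2p - 1, the mean of m + (h -
    m) s equals that of h times \<open>?w\<close>.\<close>
  let ?w = "\<lambda>x. 2 * ?i x + (1 - 2 * p)"
  have p: "0 < p" "p \<le> 1/2"
    using prob_E_pos prob_E_le by (simp_all add: p_def)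
  have int [simp]: "integrable M h"
    using h by (simp add: L1_infty_def)
  have int_i [simp]: "integrable M ?i"
    by (simp add: integrable_indicator_iff emeasure_eq_measure)
  have int_hi [simp]: "integrable M (\<lambda>x. h x * ?i x)"
    by (rule integrable_real_mult_indicator) auto
  \<comment> \<open>The two products are the contributions of \<open>E\<close> (mass p, weight 3 -
    2p) and of its complement (mass 1 - p, weight 1 - 2p).\<close>
  have "2 * (1 - p) * l = (l / p - l) * (3 - 2 * p) * p - l * (1 - 2 * p) * (1 - p)"
    using p by (simp add: field_simps)
  also have "\<dots> = expectation (\<lambda>x. ((l / p - l) * (3 - 2 * p) + l * (1 - 2 * p)) * ?i x - l * (1 - 2 * p))"
    using p by (simp add: p_def[symmetric] prob_space field_simps)
  also have "\<dots> = expectation (\<lambda>x. (l / p * ?i x - l) * ?w x)"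
    by (rule Bochner_Integration.integral_cong) (auto simp: indicator_def algebra_simps)
  also have "\<dots> \<le> expectation (\<lambda>x. h x * ?w x)"
  proof (rule integral_mono_AE)
    have "(\<lambda>x. (l / p * ?i x - l) * ?w x)
        = (\<lambda>x. ((l / p - l) * (3 - 2 * p) + l * (1 - 2 * p)) * ?i x - l * (1 - 2 * p))"
      by (auto simp: indicator_def algebra_simps)
    then show "integrable M (\<lambda>x. (l / p * ?i x - l) * ?w x)"
      by simp
    have "(\<lambda>x. h x * ?w x) = (\<lambda>x. 2 * (h x * ?i x) + h x * (1 - 2 * p))"
      by (auto simp: algebra_simps)
    then show "integrable M (\<lambda>x. h x * ?w x)"
      by simp
    show "AE x in M. (l / p * ?i x - l) * ?w x \<le> h x * ?w x"
      using ge
    proof eventually_elim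
      case (elim x)
      then show ?case
        \<comment> \<open>Here p \<le> 1/2 makes the weight nonnegative.\<close>
        using p by (intro mult_right_mono) (auto simp: p_def indicator_def)
    qed
  qed
  also have "\<dots> = expectation (\<lambda>x. 2 * (h x * ?i x) + h x * (1 - 2 * p))"
    by (simp add: algebra_simps)
  also have "\<dots> = m + expectation (\<lambda>x. 2 * (h x * ?i x) - 2 * m * ?i x - h x + m)"
    by (simp add: p_def[symmetric] m_def[symmetric] prob_space) (simp add: algebra_simps)
  also have "\<dots> \<le> \<bar>m\<bar> + expectation (\<lambda>x. \<bar>h x - m\<bar>)"
  proof (rule add_mono)
    show "expectation (\<lambda>x. 2 * (h x * ?i x) - 2 * m * ?i x - h x + m)
        \<le> expectation (\<lambda>x. \<bar>h x - m\<bar>)"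
    proof (rule integral_mono)
      \<comment> \<open>The left side factors as (h - m)(2 * \<open>?i\<close> - 1), and the second
        factor is 1 or -1.\<close>
      show "2 * (h x * ?i x) - 2 * m * ?i x - h x + m \<le> \<bar>h x - m\<bar>" for x
        by (auto simp: indicator_def)
    qed simp_all
  qed simp
  finally have "ereal (2 * (1 - p) * l) \<le> ereal (\<bar>m\<bar> + expectation (\<lambda>x. \<bar>h x - m\<bar>))"
    by simp
  also have "\<dots> \<le> variation_norm M F h"
    unfolding m_def by (rule variation_norm_ge[OF h])
  finally show ?thesis
    by (simp add: p_def)
qed

section \<open>The scaled indicator of \<open>E\<close> and its decompositions\<close>

lemma L1_norm_scaled_indicator:
  assumes "l > 0"
  shows "L1_norm M (\<lambda>x. l / prob E * indicator E x) = l"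
  using assms prob_E_pos by (simp add: L1_norm_def abs_mult)

lemma scaled_indicator_L1_infty: "(\<lambda>x. c * indicator E x) \<in> L1_infty M F"
  by (auto simp: L1_infty_def sets_F_infty integrable_indicator_iff emeasure_eq_measure
      intro!: borel_measurable_times borel_measurable_indicator)

lemma decomposition_dichotomy:
  assumes "l > 0" "decomposition M F l (\<lambda>x. l / prob E * indicator E x) g h k"
  shows "prob_sup_pos M F g = 1 \<or> variation_norm M F h \<ge> ereal (2 * (1 - prob E) * l)"
proof (cases "prob_sup_pos M F g = 1")
  case False
  then have "AE x in M. g x = 0"
    using prob_sup_pos_dichotomy[of g] assms(2) unfolding decomposition_def by blast
  moreover have "AE x in M. l / prob E * indicator E x = g x + h x + k x"
    "AE x in M. 0 \<le> k x \<and> k x \<le> l"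
    using assms(2) by (auto simp: decomposition_def)
  ultimately have "AE x in M. h x \<ge> l / prob E * indicator E x - l"
    by eventually_elim auto
  then have "variation_norm M F h \<ge> ereal (2 * (1 - prob E) * l)"
    using assms by (intro variation_norm_ge_of_ge) (auto simp: decomposition_def)
  then show ?thesis ..
qed simp

end

section \<open>Realization on an arbitrary type with two distinct points\<close>

lemma ex_complete_two_set_filtration:
  fixes a b :: 'a
  assumes "a \<noteq> b" "0 < p" "p \<le> 1/2"
  obtains M :: "'a measure" and E F
  where "two_set_filtration M E F" "complete_measure M" "discrete_filtration M F" "measure M E = p"
proof -
  \<comment> \<open>The Bernoulli law is transported to \<open>a\<close> and \<open>b\<close>. Every
    set is measurable, so completeness is immediate; \<open>{a}\<close> serves as
    \<open>E\<close>.\<close>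
  define M where "M = measure_pmf (map_pmf (\<lambda>t. if t then a else b) (bernoulli_pmf p))"
  define F :: "nat \<Rightarrow> 'a measure" where
    "F n = sigma UNIV (if n \<le> 1 then {} else {{}, {a}, UNIV - {a}, UNIV})" for n
  have vimage: "(\<lambda>t. if t then a else b) -` {a} = {True}"
    using assms(1) by (auto split: if_splits)
  have prob_a: "measure M {a} = p"
    using assms vimage by (simp add: M_def pmf_map measure_pmf_single)
  have sp: "space M = UNIV" and st: "sets M = UNIV"
    by (simp_all add: M_def)
  have sets_F: "sets (F n) = (if n \<le> 1 then {{}, UNIV} else {{}, {a}, UNIV - {a}, UNIV})" for n
    using sigma_algebra.sigma_sets_eq[OF sigma_algebra_single_set[of "{a}" UNIV]]
    by (simp add: F_def sigma_sets_empty_eq)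
  have space_F: "space (F n) = UNIV" for n
    by (simp add: F_def)
  interpret P: prob_space M
    unfolding M_def by (rule measure_pmf.prob_space_axioms)
  show thesis
  proof
    show "two_set_filtration M {a} F"
      by unfold_locales (use assms in \<open>auto simp: prob_a sets_F sp st\<close>)
    show "complete_measure M"
      by unfold_locales (simp add: st)
    show "discrete_filtration M F"
      by (auto simp: discrete_filtration_def subalgebra_def filtration_def space_F sets_F sp st)
    show "measure M {a} = p"
      by (rule prob_a)
  qed
qed

theorem corollary3p13:
  shows
    "(\<forall>(M :: 'a measure) E p F l f.
        prob_space M \<and> E \<in> sets M \<and> measure M E = p \<and> 0 < p \<and> p \<le> 1/2 \<and>
        sets (F 1) = {{}, space M} \<and>
        (\<forall>n\<ge>2. sets (F n) = {{}, E, space M - E, space M}) \<and>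
        l > 0 \<and> f = (\<lambda>x. l / p * indicator E x)
        \<longrightarrow> sets (F_infty M F) = {{}, E, space M - E, space M} \<and>
            L1_norm M f = l \<and>
            (\<forall>g h k. decomposition M F l f g h k \<longrightarrow>
               prob_sup_pos M F g = 1 \<or>
               variation_norm M F h \<ge> ereal (2 * (1 - p) * L1_norm M f)))
     \<and>
     ((\<exists>x y :: 'b. x \<noteq> y) \<longrightarrow>
      \<not> (\<exists>c1 c2 :: real. c1 < 1 \<and> c2 < 2 \<and>
           (\<forall>(M :: 'b measure) F f l.
              prob_space M \<and> complete_measure M \<and> discrete_filtration M F \<and>
              f \<in> L1_infty M F \<and> (AE x in M. 0 \<le> f x) \<and> l > 0
              \<longrightarrow> (\<exists>g h k. decomposition M F l f g h k \<and>
                     prob_sup_pos M F g \<le> c1 * (L1_norm M f / l) \<and>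
                     variation_norm M F h \<le> ereal (c2 * L1_norm M f)))))"
proof (rule conjI; (intro allI impI)?)
  fix M :: "'a measure" and E p l f and F :: "nat \<Rightarrow> 'a measure"
  assume a: "prob_space M \<and> E \<in> sets M \<and> measure M E = p \<and> 0 < p \<and> p \<le> 1/2 \<and>
        sets (F 1) = {{}, space M} \<and>
        (\<forall>n\<ge>2. sets (F n) = {{}, E, space M - E, space M}) \<and>
        l > 0 \<and> f = (\<lambda>x. l / p * indicator E x)"
  then interpret prob_space M by blast
  interpret two_set_filtration M E F
    by unfold_locales (use a in auto)
  show "sets (F_infty M F) = {{}, E, space M - E, space M} \<and>
            L1_norm M f = l \<and>
            (\<forall>g h k. decomposition M F l f g h k \<longrightarrow>
               prob_sup_pos M F g = 1 \<or>
               variation_norm M F h \<ge> ereal (2 * (1 - p) * L1_norm M f))"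
    using a sets_F_infty L1_norm_scaled_indicator decomposition_dichotomy by auto
next
  assume "\<exists>x y :: 'b. x \<noteq> y"
  then obtain a b :: 'b where "a \<noteq> b" by blast
  show "\<not> (\<exists>c1 c2 :: real. c1 < 1 \<and> c2 < 2 \<and>
           (\<forall>(M :: 'b measure) F f l.
              prob_space M \<and> complete_measure M \<and> discrete_filtration M F \<and>
              f \<in> L1_infty M F \<and> (AE x in M. 0 \<le> f x) \<and> l > 0
              \<longrightarrow> (\<exists>g h k. decomposition M F l f g h k \<and>
                     prob_sup_pos M F g \<le> c1 * (L1_norm M f / l) \<and>
                     variation_norm M F h \<le> ereal (c2 * L1_norm M f))))"
  proof (rule notI, elim exE conjE)
    fix c1 c2 :: real
    assume c: "c1 < 1" "c2 < 2"
    assume dec: "\<forall>(M :: 'b measure) F f l.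
              prob_space M \<and> complete_measure M \<and> discrete_filtration M F \<and>
              f \<in> L1_infty M F \<and> (AE x in M. 0 \<le> f x) \<and> l > 0
              \<longrightarrow> (\<exists>g h k. decomposition M F l f g h k \<and>
                     prob_sup_pos M F g \<le> c1 * (L1_norm M f / l) \<and>
                     variation_norm M F h \<le> ereal (c2 * L1_norm M f))"
    \<comment> \<open>The target \<open>c2 < 2 * (1 - p)\<close> means p < (2 - c2)/2; half of that
      bound is taken, capped at 1/2.\<close>
    define p where "p = min (1/2) ((2 - c2) / 4)"
    have p: "0 < p" "p \<le> 1/2" "c2 < 2 * (1 - p)"
      using c by (auto simp: p_def min_def field_simps)
    obtain M :: "'b measure" and E F where
      MEF: "two_set_filtration M E F" "complete_measure M" "discrete_filtration M F" "measure M E = p"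
      using ex_complete_two_set_filtration[OF \<open>a \<noteq> b\<close> p(1,2)] by blast
    interpret two_set_filtration M E F by fact
    \<comment> \<open>Taking \<lambda> = 1 normalizes the norm of \<open>?f\<close> to 1, so the two
      bounds become \<open>c1\<close> and \<open>c2\<close>.\<close>
    let ?f = "\<lambda>x. 1 / prob E * indicator E x :: real"
    have norm_f: "L1_norm M ?f = 1"
      by (rule L1_norm_scaled_indicator) simp
    have "prob_space M \<and> complete_measure M \<and> discrete_filtration M F \<and>
        ?f \<in> L1_infty M F \<and> (AE x in M. 0 \<le> ?f x) \<and> (1::real) > 0"
      using MEF(2,3) prob_space_axioms scaled_indicator_L1_infty[of "1 / prob E"] by auto
    with dec have "\<exists>g h k. decomposition M F 1 ?f g h k \<and>
        prob_sup_pos M F g \<le> c1 * (L1_norm M ?f / 1) \<and>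
        variation_norm M F h \<le> ereal (c2 * L1_norm M ?f)"
      by blast
    then obtain g h k where ghk: "decomposition M F 1 ?f g h k"
      "prob_sup_pos M F g \<le> c1" "variation_norm M F h \<le> ereal c2"
      unfolding norm_f by auto
    \<comment> \<open>Because \<open>c1 < 1\<close>, the first alternative of the dichotomy is
      impossible.\<close>
    have "ereal (2 * (1 - p)) \<le> variation_norm M F h"
      using decomposition_dichotomy[OF _ ghk(1)] ghk(2) c(1) MEF(4) by auto
    then have "ereal (2 * (1 - p)) \<le> ereal c2"
      using ghk(3) by (rule order_trans)
    with p(3) show False by simp
  qed
qed

end
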